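(* Let $n\ge 2$ and $m\ge 3$ be integers, and let $G$ be a multigraph that has the maximum number of cycles among all multigraphs with $n$ vertices and $m$ edges. Let $s=\left\lfloor\frac{m}{n-1}\right\rfloor$ and $\alpha=\frac{m}{n-1}-s$. (i) If $\frac{m}{n-1}\ge 3$, then $$\tfrac{8}{27}\,s\left(s^{1-\alpha}(s+1)^{\alpha}\right)^{n-1}\le C(G)\le \tfrac34\,\Delta(G)\left(s^{1-\alpha}(s+1)^{\alpha}\right)^{n-1}.$$ (ii) If $\frac{m}{n-1}\le 3$, then $$4(\sqrt[3]{3})^{m-4}\le C(G)<\tfrac34\,\Delta(G)\cdot(\sqrt[3]{3})^m.$$
   Context: Multigraphs are finite, may have parallel edges, and have no loops. The degree of a vertex is the number of edges incident to it (parallel edges counted separately), and $\Delta(G)$ is the maximum degree. A cycle in a multigraph $G$ is a set of $k\ge 2$ distinct vertices and $k$ distinct edges $\{v_1,e_1,v_2,e_2,\dots,v_k,e_k\}$ such that $e_i$ joins $v_i$ and $v_{i+1}$ for $1\le i<k$ and $e_k$ joins $v_k$ and $v_1$ (so two parallel edges together with their two endpoints form a cycle; choice of starting point and direction is irrelevant). $C(G)$ denotes the number of cycles in $G$. *)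

theory Defs
  imports Complex_Main
begin

text \<open>Edges are named objects, and \<open>ends\<close> gives the set of endpoints of an edge, so parallel
  edges are distinct elements of \<open>edges\<close> with the same value of \<open>ends\<close>.\<close>

record ('v, 'e) mgraph =
  vertices :: "'v set"
  edges :: "'e set"
  ends :: "'e \<Rightarrow> 'v set"

text \<open>Loops are excluded because every edge has exactly two endpoints.\<close>

definition multigraph :: "('v, 'e) mgraph \<Rightarrow> bool" where
  "multigraph G \<longleftrightarrow> finite (vertices G) \<and> finite (edges G) \<and>
     (\<forall>e\<in>edges G. ends G e \<subseteq> vertices G \<and> card (ends G e) = 2)"

definition vertex_degree :: "('v, 'e) mgraph \<Rightarrow> 'v \<Rightarrow> nat" where
  "vertex_degree G v = card {e \<in> edges G. v \<in> ends G e}"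

definition max_degree :: "('v, 'e) mgraph \<Rightarrow> nat" where
  "max_degree G = Max (vertex_degree G ` vertices G)"

text \<open>A cyclic traversal \<open>v\<^sub>0, e\<^sub>0, v\<^sub>1, e\<^sub>1, \<dots>, v\<^sub>k\<^sub>-\<^sub>1, e\<^sub>k\<^sub>-\<^sub>1\<close> of a cycle, given by its list of vertices
  and its list of edges, with indices modulo \<open>k\<close>.\<close>

definition traverses_cycle :: "('v, 'e) mgraph \<Rightarrow> 'v list \<Rightarrow> 'e list \<Rightarrow> bool" where
  "traverses_cycle G vs es \<longleftrightarrow>
     length vs = length es \<and> length vs \<ge> 2 \<and>
     distinct vs \<and> distinct es \<and>
     set vs \<subseteq> vertices G \<and> set es \<subseteq> edges G \<and>
     (\<forall>i < length es. ends G (es ! i) = {vs ! i, vs ! (Suc i mod length vs)})"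

text \<open>A cycle is the set of vertices and edges occurring in a traversal, kept here as a pair of a
  vertex set and an edge set; hence neither the starting point nor the direction matters.\<close>

definition graph_cycles :: "('v, 'e) mgraph \<Rightarrow> ('v set \<times> 'e set) set" where
  "graph_cycles G = {(set vs, set es) | vs es. traverses_cycle G vs es}"

definition cycle_number :: "('v, 'e) mgraph \<Rightarrow> nat" where
  "cycle_number G = card (graph_cycles G)"

text \<open>The competitors range over multigraphs whose vertices and edges are natural numbers. As
  multigraphs are finite, each one, over whatever types, is isomorphic to one of these.\<close>

definition cycle_maximal :: "nat \<Rightarrow> nat \<Rightarrow> ('v, 'e) mgraph \<Rightarrow> bool" where
  "cycle_maximal n m G \<longleftrightarrow>
     multigraph G \<and> card (vertices G) = n \<and> card (edges G) = m \<and>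
     (\<forall>H :: (nat, nat) mgraph.
        multigraph H \<and> card (vertices H) = n \<and> card (edges H) = m
          \<longrightarrow> cycle_number H \<le> cycle_number G)"

end

theory Submission
  imports Defs "HOL-Library.Nat_Bijection" "HOL-Library.FuncSet"
begin

text \<open>Upper bounds: choose reals \<open>A, L \<ge> 1\<close> with \<open>d \<le> A * L ^ d\<close> for all natural \<open>d\<close>. A path from
  \<open>u\<close> leaves \<open>u\<close> through one of \<open>d(u)\<close> edges and then avoids \<open>u\<close>, so by induction there are at most
  \<open>A ^ (n - 1) * L ^ m\<close> paths between two vertices. A cycle through \<open>v\<close> is a path closed by either of its
  two edges at \<open>v\<close>, hence at most \<open>d(v) / 2 * A ^ (n - 1) * L ^ (m - 1)\<close> cycles pass through \<open>v\<close>. Deleting \<open>v\<close>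
  divides \<open>A ^ (n - 1) * L ^ m\<close> by at least 3 if \<open>d(v) \<ge> 3\<close>, and the geometric series
  \<open>1/2 + 1/6 + \<dots> = 3/4\<close> gives the constant. In (i), \<open>A * L ^ d\<close> is the exponential function through
  \<open>(s, s)\<close> and \<open>(s + 1, s + 1)\<close>; in (ii), \<open>A = 1\<close> and \<open>L\<close> is the cube root of 3.

  Lower bounds: a cycle with edges replaced by classes of parallel edges has at least as many cycles as
  the product of the class sizes. In (i), for at least four vertices, balanced classes along a spanning path
  are thinned out to close it; in (ii), almost all classes have size 3.\<close>

subsection \<open>Counting paths and cycles from above\<close>

text \<open>Paths are recorded by their edge sets, as these determine the cycles that the paths come
  from. On leaving \<open>u\<close>, all edges at \<open>u\<close> are discarded: this forbids a
  return to \<open>u\<close> and leaves edges on one vertex fewer, the shape that the counting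
  induction needs.\<close>

inductive path_edges :: "('e \<Rightarrow> 'v set) \<Rightarrow> 'e set \<Rightarrow> 'v \<Rightarrow> 'v \<Rightarrow> 'e set \<Rightarrow> bool" for f where
  nil: "path_edges f E v v {}"
| step: "\<lbrakk>u \<noteq> v; e \<in> E; f e = {u, w}; path_edges f {e \<in> E. u \<notin> f e} w v F\<rbrakk>
    \<Longrightarrow> path_edges f E u v (insert e F)"

lemma path_edges_subset: "path_edges f E u v F \<Longrightarrow> F \<subseteq> E"
  by (induction rule: path_edges.induct) auto

lemma finite_path_edges: "finite E \<Longrightarrow> finite {F. path_edges f E u v F}"
  by (rule finite_subset[of _ "Pow E"]) (auto dest: path_edges_subset)

lemma card_path_edges_le:
  fixes A L :: real
  assumes AL: "A \<ge> 1" "L \<ge> 1" "\<And>d. real d \<le> A * L ^ d"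
  assumes "finite V" "card V = Suc k" "finite E"
    and "\<And>e. e \<in> E \<Longrightarrow> f e \<subseteq> V \<and> card (f e) = 2" and "u \<in> V"
  shows "real (card {F. path_edges f E u v F}) \<le> A ^ k * L ^ card E"
  using assms(4-)
proof (induction k arbitrary: V E u)
  case 0
  then obtain x where "V = {x}" by (auto simp: card_Suc_eq)
  have "E = {}"
  proof (rule ccontr)
    assume "E \<noteq> {}"
    then obtain e where "f e \<subseteq> {x}" "card (f e) = 2" using 0(4) \<open>V = {x}\<close> by auto
    then show False using card_mono[of "{x}" "f e"] by auto
  qed
  then have "{F. path_edges f E u v F} \<subseteq> {{}}" by (auto dest: path_edges_subset)
  then have "card {F. path_edges f E u v F} \<le> 1"
    by (metis card_mono finite.emptyI finite.insertI is_singletonI is_singleton_altdef)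
  then show ?case by (simp add: \<open>E = {}\<close>)
next
  case (Suc k)
  show ?case
  proof (cases "u = v")
    case True
    then have "{F. path_edges f E u v F} \<subseteq> {{}}" by (auto elim: path_edges.cases)
    then have "card {F. path_edges f E u v F} \<le> 1"
      by (metis card_mono finite.emptyI finite.insertI is_singletonI is_singleton_altdef)
    moreover have "1 \<le> A ^ Suc k * L ^ card E"
      using AL by (metis mult_mono' one_le_power mult_1 zero_le_one)
    ultimately show ?thesis by linarith
  next
    case False
    define E' where "E' = {e \<in> E. u \<notin> f e}"
    define U where "U = {e \<in> E. u \<in> f e}"
    define other where "other e = (SOME w. f e = {u, w})" for e
    have fin: "finite U" "finite E'" using Suc.prems(3) by (auto simp: U_def E'_def)
    have E: "E = U \<union> E'" "U \<inter> E' = {}" by (auto simp: U_def E'_def)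
    have other: "f e = {u, other e}" "other e \<in> V - {u}" if "e \<in> U" for e
    proof -
      have c: "card (f e) = 2" "u \<in> f e" "f e \<subseteq> V" using that Suc.prems(4) by (auto simp: U_def)
      then obtain w where w: "f e = {u, w}" "w \<noteq> u"
        by (auto simp: card_2_iff) (metis insert_commute)
      then show 1: "f e = {u, other e}" unfolding other_def by (metis (mono_tags, lifting) someI)
      then have "other e = w" using w by (auto simp: doubleton_eq_iff)
      then show "other e \<in> V - {u}" using w c by auto
    qed
    have sub: "{F. path_edges f E u v F}
        \<subseteq> (\<Union>e\<in>U. insert e ` {F. path_edges f E' (other e) v F})"
    proof
      fix F assume "F \<in> {F. path_edges f E u v F}"
      then have "path_edges f E u v F" by simp
      then show "F \<in> (\<Union>e\<in>U. insert e ` {F. path_edges f E' (other e) v F})"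
      proof cases
        case nil then show ?thesis using False by simp
      next
        case (step e w F')
        then have "e \<in> U" by (auto simp: U_def)
        then have "other e = w" using other[OF \<open>e \<in> U\<close>] step(4) by (auto simp: doubleton_eq_iff)
        then show ?thesis using step \<open>e \<in> U\<close> by (auto simp: E'_def)
      qed
    qed
    have "card {F. path_edges f E u v F}
        \<le> card (\<Union>e\<in>U. insert e ` {F. path_edges f E' (other e) v F})"
      by (intro card_mono sub) (auto intro: fin finite_path_edges)
    also have "\<dots> \<le> (\<Sum>e\<in>U. card (insert e ` {F. path_edges f E' (other e) v F}))"
      by (rule card_UN_le[OF fin(1)])
    also have "\<dots> \<le> (\<Sum>e\<in>U. card {F. path_edges f E' (other e) v F})"
      by (intro sum_mono card_image_le finite_path_edges fin)
    finally have "real (card {F. path_edges f E u v F})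
        \<le> (\<Sum>e\<in>U. real (card {F. path_edges f E' (other e) v F}))"
      by (simp only: of_nat_sum[symmetric] of_nat_le_iff)
    also have "\<dots> \<le> (\<Sum>e\<in>U. A ^ k * L ^ card E')"
    proof (rule sum_mono)
      fix e assume "e \<in> U"
      show "real (card {F. path_edges f E' (other e) v F}) \<le> A ^ k * L ^ card E'"
        using other(2)[OF \<open>e \<in> U\<close>] Suc.prems fin(2)
        by (intro Suc.IH[of "V - {u}"]) (auto simp: E'_def)
    qed
    also have "\<dots> = real (card U) * (A ^ k * L ^ card E')" by simp
    \<comment> \<open>The weight inequality at \<open>d = card U\<close> pays for the choice of the
      first edge, with one factor \<open>A\<close> for the vertex \<open>u\<close> and one factor
      \<open>L\<close> for each edge discarded with it.\<close>
    also have "\<dots> \<le> (A * L ^ card U) * (A ^ k * L ^ card E')"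
      using AL by (intro mult_right_mono) auto
    also have "\<dots> = A ^ Suc k * L ^ card E"
      using E fin by (simp add: card_Un_disjoint power_add)
    finally show ?thesis .
  qed
qed

text \<open>Each later edge joins two later vertices of the list. By distinctness neither is the
  first vertex, so these edges survive when the edges at the first vertex are discarded.\<close>

lemma path_edges_list:
  assumes "length vs = Suc (length es)" "distinct vs" "set es \<subseteq> E"
    and "\<And>i. i < length es \<Longrightarrow> f (es ! i) = {vs ! i, vs ! Suc i}"
  shows "path_edges f E (hd vs) (last vs) (set es)"
  using assms
proof (induction es arbitrary: vs E)
  case Nil
  then obtain v where "vs = [v]" by (auto simp: length_Suc_conv)
  then show ?case by (simp add: path_edges.nil)
next
  case (Cons e es)
  then obtain u w ws where vs: "vs = u # w # ws" by (auto simp: length_Suc_conv)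
  have e: "f e = {u, w}" using Cons.prems(4)[of 0] vs by simp
  have step: "f (es ! i) = {(w # ws) ! i, (w # ws) ! Suc i}" if "i < length es" for i
    using Cons.prems(4)[of "Suc i"] that vs by simp
  have len: "length (w # ws) = Suc (length es)" using Cons.prems(1) vs by simp
  have "u \<notin> f e'" if e': "e' \<in> set es" for e'
  proof -
    obtain i where i: "i < length es" "e' = es ! i" using e' unfolding in_set_conv_nth by blast
    have "(w # ws) ! i \<in> set (w # ws)" by (rule nth_mem) (use len i in linarith)
    moreover have "(w # ws) ! Suc i \<in> set (w # ws)" by (rule nth_mem) (use len i in linarith)
    ultimately have "f e' \<subseteq> set (w # ws)" using step[OF i(1)] i(2) by (simp only:) blast
    then show ?thesis using Cons.prems(2) vs by auto
  qed
  then have "path_edges f {e \<in> E. u \<notin> f e} (hd (w # ws)) (last (w # ws)) (set es)"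
    using Cons.prems vs step len by (intro Cons.IH) auto
  moreover have "u \<noteq> last (w # ws)" using Cons.prems(2) vs
    by (metis distinct.simps(2) last_in_set list.distinct(1))
  ultimately show ?case
    using path_edges.step[of u "last (w # ws)" e E f w "set es"] e Cons.prems(3) vs by auto
qed

section \<open>From cycles to paths: rotating and cutting a traversal\<close>

lemma traverses_cycle_rotate1:
  assumes "traverses_cycle G vs es" shows "traverses_cycle G (rotate1 vs) (rotate1 es)"
proof -
  have len: "length vs = length es" "length vs \<ge> 2"
    and ends: "\<And>i. i < length es \<Longrightarrow> ends G (es ! i) = {vs ! i, vs ! (Suc i mod length vs)}"
    using assms by (auto simp: traverses_cycle_def)
  have "ends G (rotate1 es ! i) = {rotate1 vs ! i, rotate1 vs ! (Suc i mod length vs)}"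
    if "i < length es" for i
  proof -
    have "Suc i mod length vs < length vs" using len by (intro mod_less_divisor) linarith
    then show ?thesis
      using ends[of "Suc i mod length es"] that len
      by (simp add: nth_rotate1 mod_Suc_eq)
  qed
  then show ?thesis using assms by (simp add: traverses_cycle_def)
qed

lemma traverses_cycle_rotate:
  "traverses_cycle G vs es \<Longrightarrow> traverses_cycle G (rotate k vs) (rotate k es)"
  by (induction k) (auto intro: traverses_cycle_rotate1)

text \<open>Rotation puts \<open>v\<close> first, and then the first and the last edge contain it.
  Distinctness of the edge list keeps these two apart even in a digon.\<close>

lemma cycle_through_vertex:
  assumes "(W, F) \<in> graph_cycles G" "v \<in> W"
  obtains e e' where "e \<noteq> e'" "e \<in> F" "e' \<in> F" "v \<in> ends G e" "v \<in> ends G e'"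
proof -
  obtain vs es where t: "traverses_cycle G vs es" and W: "W = set vs" "F = set es"
    using assms(1) by (auto simp: graph_cycles_def)
  obtain k where k: "k < length vs" "vs ! k = v" using assms(2) W by (auto simp: in_set_conv_nth)
  have t': "traverses_cycle G (rotate k vs) (rotate k es)" by (rule traverses_cycle_rotate[OF t])
  define ws fs where "ws = rotate k vs" and "fs = rotate k es"
  have ws0: "ws ! 0 = v" using k nth_rotate[of 0 vs k] by (cases vs) (auto simp: ws_def)
  have len: "length ws = length fs" "length ws \<ge> 2" and d: "distinct fs"
    and ends: "\<And>i. i < length fs \<Longrightarrow> ends G (fs ! i) = {ws ! i, ws ! (Suc i mod length ws)}"
    using t' by (auto simp: traverses_cycle_def ws_def fs_def)
  show ?thesis
  proof
    show "fs ! 0 \<noteq> fs ! (length fs - 1)" using d len by (subst nth_eq_iff_index_eq) auto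
    have "set fs = F" by (simp add: fs_def W)
    then show "fs ! 0 \<in> F" "fs ! (length fs - 1) \<in> F"
      using len nth_mem[of 0 fs] nth_mem[of "length fs - 1" fs] by fastforce+
    show "v \<in> ends G (fs ! 0)" using ends[of 0] len ws0 by (cases fs) simp_all
    show "v \<in> ends G (fs ! (length fs - 1))"
      using ends[of "length fs - 1"] len ws0 by (cases fs) simp_all
  qed
qed

text \<open>Rotation by \<open>Suc k\<close> moves \<open>e\<close> from position \<open>k\<close>
  to the end; cutting it off leaves a path between the ends of \<open>e\<close>.\<close>

lemma cycle_through_edge_path:
  assumes "(W, F) \<in> graph_cycles G" "e \<in> F" "ends G e = {u, v}"
  shows "path_edges (ends G) (edges G - {e}) u v (F - {e})"
proof -
  obtain vs es where t: "traverses_cycle G vs es" and W: "W = set vs" "F = set es"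
    using assms(1) by (auto simp: graph_cycles_def)
  obtain k where k: "k < length es" "es ! k = e" using assms(2) W by (auto simp: in_set_conv_nth)
  define ws fs where "ws = rotate (Suc k) vs" and "fs = rotate (Suc k) es"
  have t': "traverses_cycle G ws fs"
    unfolding ws_def fs_def by (rule traverses_cycle_rotate[OF t])
  have len: "length ws = length fs" "length ws \<ge> 2" and d: "distinct fs" "distinct ws"
    and sub: "set fs \<subseteq> edges G"
    and ends: "\<And>i. i < length fs \<Longrightarrow> ends G (fs ! i) = {ws ! i, ws ! (Suc i mod length ws)}"
    using t' by (auto simp: traverses_cycle_def)
  have "last fs = fs ! (length fs - 1)" using len by (intro last_conv_nth) auto
  also have "\<dots> = es ! ((Suc k + (length es - 1)) mod length es)"
    using k by (simp add: fs_def nth_rotate del: rotate_Suc)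
  also have "(Suc k + (length es - 1)) mod length es = (k + length es) mod length es"
    using k by (intro arg_cong[of _ _ "\<lambda>x. x mod length es"]) simp
  also have "\<dots> = k" using k by simp
  finally have last: "last fs = e" using k by simp
  define gs where "gs = butlast fs"
  have fs: "fs = gs @ [e]" using last len
    by (metis append_butlast_last_id gs_def length_0_conv not_numeral_le_zero)
  have leng: "length ws = Suc (length gs)" using fs len by simp
  have endsg: "ends G (gs ! i) = {ws ! i, ws ! Suc i}" if "i < length gs" for i
    using ends[of i] that leng fs by (simp add: nth_append)
  have ende: "ends G e = {last ws, hd ws}"
    using ends[of "length gs"] leng fs by (simp add: nth_append last_conv_nth hd_conv_nth)
       (metis One_nat_def diff_Suc_1 hd_conv_nth last_conv_nth length_0_conv nat.distinct(1))
  have Fg: "F - {e} = set gs" using fs d W set_rotate[of "Suc k" es, folded fs_def]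
    by (auto simp del: set_rotate rotate_Suc)
  have gsub: "set gs \<subseteq> edges G - {e}" using sub fs d by auto
  have 1: "path_edges (ends G) (edges G - {e}) (hd ws) (last ws) (F - {e})"
    unfolding Fg using leng d gsub endsg by (intro path_edges_list) auto
  \<comment> \<open>The unordered pair \<open>{u, v}\<close> does not tell at which end the cut
    traversal starts, so the reversed lists supply the path in the other direction.\<close>
  have 2: "path_edges (ends G) (edges G - {e}) (hd (rev ws)) (last (rev ws)) (set (rev gs))"
  proof (rule path_edges_list)
    fix i assume i: "i < length (rev gs)"
    then have "Suc (length gs - Suc i) = length gs - i" by simp
    then show "ends G (rev gs ! i) = {rev ws ! i, rev ws ! Suc i}"
      using endsg[of "length gs - Suc i"] i leng by (simp add: rev_nth insert_commute)
  qed (use leng d gsub in auto)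
  then have 2: "path_edges (ends G) (edges G - {e}) (last ws) (hd ws) (F - {e})"
    using Fg by (simp add: hd_rev last_rev)
  show ?thesis using 1 2 ende assms(3) by (auto simp: doubleton_eq_iff)
qed

text \<open>Consequently a cycle is determined by its edge set, and a cycle that avoids a vertex
  uses no edge at it.\<close>

lemma cycle_vertices_eq:
  assumes "(W, F) \<in> graph_cycles G" shows "W = \<Union> (ends G ` F)"
proof -
  obtain vs es where t: "traverses_cycle G vs es" and W: "W = set vs" "F = set es"
    using assms(1) by (auto simp: graph_cycles_def)
  have len: "length vs = length es" "length vs \<ge> 2"
    and ends: "\<And>i. i < length es \<Longrightarrow> ends G (es ! i) = {vs ! i, vs ! (Suc i mod length vs)}"
    using t by (auto simp: traverses_cycle_def)
  have "W \<subseteq> \<Union> (ends G ` F)"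
  proof
    fix x assume "x \<in> W"
    then obtain i where i: "i < length vs" "x = vs ! i" unfolding W in_set_conv_nth by blast
    then have "es ! i \<in> F" "x \<in> ends G (es ! i)" using ends[of i] len by (auto simp: W)
    then show "x \<in> \<Union> (ends G ` F)" by blast
  qed
  moreover have "\<Union> (ends G ` F) \<subseteq> W"
  proof
    fix x assume "x \<in> \<Union> (ends G ` F)"
    then obtain i where i: "i < length es" "x \<in> ends G (es ! i)"
      unfolding W by (auto simp: in_set_conv_nth)
    moreover have "vs ! i \<in> W" "vs ! (Suc i mod length vs) \<in> W"
      unfolding W using i len by (intro nth_mem mod_less_divisor; linarith)+
    ultimately show "x \<in> W" using ends[of i] by auto
  qed
  ultimately show ?thesis by simp
qed

lemma finite_graph_cycles:
  assumes "multigraph G" shows "finite (graph_cycles G)"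
  by (rule finite_subset[of _ "Pow (vertices G) \<times> Pow (edges G)"])
    (use assms in \<open>auto simp: graph_cycles_def traverses_cycle_def multigraph_def\<close>)

text \<open>Removing \<open>e\<close> maps the cycles through \<open>e\<close> injectively to paths
  between its ends in the graph without \<open>e\<close>; hence the exponent is one less than the
  number of edges.\<close>

lemma card_cycles_through_edge_le:
  fixes A L :: real
  assumes AL: "A \<ge> 1" "L \<ge> 1" "\<And>d. real d \<le> A * L ^ d"
  assumes G: "multigraph G" "card (vertices G) = Suc k" and e: "e \<in> edges G"
  shows "real (card {c \<in> graph_cycles G. e \<in> snd c}) \<le> A ^ k * L ^ (card (edges G) - 1)"
proof -
  obtain u v where uv: "ends G e = {u, v}" using G(1) e by (auto simp: multigraph_def card_2_iff)
  let ?P = "{F. path_edges (ends G) (edges G - {e}) u v F}"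
  have fin: "finite (edges G)" using G by (simp add: multigraph_def)
  have "card {c \<in> graph_cycles G. e \<in> snd c} \<le> card ?P"
  proof (rule card_inj_on_le)
    show "inj_on (\<lambda>c. snd c - {e}) {c \<in> graph_cycles G. e \<in> snd c}"
    proof (rule inj_onI)
      fix c c' assume c: "c \<in> {c \<in> graph_cycles G. e \<in> snd c}" "c' \<in> {c \<in> graph_cycles G. e \<in> snd c}"
        and "snd c - {e} = snd c' - {e}"
      then have "snd c = snd c'" by auto
      moreover have "fst c = \<Union> (ends G ` snd c)" "fst c' = \<Union> (ends G ` snd c')"
        using c cycle_vertices_eq[of "fst c" "snd c"] cycle_vertices_eq[of "fst c'" "snd c'"] by auto
      ultimately show "c = c'" by (simp add: prod_eq_iff)
    qed
    show "(\<lambda>c. snd c - {e}) ` {c \<in> graph_cycles G. e \<in> snd c} \<subseteq> ?P"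
      using cycle_through_edge_path[OF _ _ uv] by auto
    show "finite ?P" using fin by (intro finite_path_edges) auto
  qed
  also have "real (card ?P) \<le> A ^ k * L ^ card (edges G - {e})"
    by (rule card_path_edges_le[OF AL, of "vertices G"])
      (use G fin uv e in \<open>auto simp: multigraph_def\<close>)
  finally show ?thesis using e fin by simp
qed

text \<open>Double counting of pairs of a cycle through \<open>v\<close> and one of its edges at
  \<open>v\<close>: every cycle occurs in at least two pairs, which yields the factor 1/2.\<close>

lemma card_cycles_through_vertex_le:
  fixes A L :: real
  assumes AL: "A \<ge> 1" "L \<ge> 1" "\<And>d. real d \<le> A * L ^ d"
  assumes G: "multigraph G" "card (vertices G) = Suc k"
  shows "real (card {c \<in> graph_cycles G. v \<in> fst c})
    \<le> real (vertex_degree G v) / 2 * (A ^ k * L ^ (card (edges G) - 1))"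
proof -
  let ?C = "{c \<in> graph_cycles G. v \<in> fst c}" and ?U = "{e \<in> edges G. v \<in> ends G e}"
  have finC: "finite ?C" using finite_graph_cycles[OF G(1)] by simp
  have finU: "finite ?U" using G by (simp add: multigraph_def)
  have two: "2 \<le> card {e \<in> ?U. e \<in> snd c}" if "c \<in> ?C" for c
  proof -
    have c: "(fst c, snd c) \<in> graph_cycles G" "v \<in> fst c" using that by auto
    obtain e e' where e: "e \<noteq> e'" "e \<in> snd c" "e' \<in> snd c" "v \<in> ends G e" "v \<in> ends G e'"
      using cycle_through_vertex[OF c] .
    have "snd c \<subseteq> edges G" using that by (auto simp: graph_cycles_def traverses_cycle_def)
    then have "{e, e'} \<subseteq> {e \<in> ?U. e \<in> snd c}" using e by auto
    then have "card {e, e'} \<le> card {e \<in> ?U. e \<in> snd c}" using finU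
      by (intro card_mono finite_subset[of "{e \<in> ?U. e \<in> snd c}" ?U]) auto
    then show ?thesis using e by simp
  qed
  have "2 * card ?C = (\<Sum>c\<in>?C. 2)" by simp
  also have "\<dots> \<le> (\<Sum>c\<in>?C. card {e \<in> ?U. e \<in> snd c})" by (intro sum_mono two)
  also have "\<dots> = (\<Sum>e\<in>?U. card {c \<in> ?C. e \<in> snd c})"
    using sum.swap_restrict[OF finC finU, of "\<lambda>_ _. 1::nat" "\<lambda>c e. e \<in> snd c"] by simp
  also have "\<dots> \<le> (\<Sum>e\<in>?U. card {c \<in> graph_cycles G. e \<in> snd c})"
    using finite_graph_cycles[OF G(1)] by (intro sum_mono card_mono) auto
  finally have "real (2 * card ?C) \<le> (\<Sum>e\<in>?U. real (card {c \<in> graph_cycles G. e \<in> snd c}))"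
    by (simp only: of_nat_sum[symmetric] of_nat_le_iff)
  also have "\<dots> \<le> (\<Sum>e\<in>?U. A ^ k * L ^ (card (edges G) - 1))"
    by (intro sum_mono card_cycles_through_edge_le[OF AL G]) auto
  also have "\<dots> = real (vertex_degree G v) * (A ^ k * L ^ (card (edges G) - 1))"
    by (simp add: vertex_degree_def)
  finally show ?thesis by simp
qed

section \<open>Induction by deleting a vertex\<close>

definition delete_vertex :: "('v, 'e) mgraph \<Rightarrow> 'v \<Rightarrow> ('v, 'e) mgraph" where
  "delete_vertex G v =
    G\<lparr>vertices := vertices G - {v}, edges := {e \<in> edges G. v \<notin> ends G e}\<rparr>"

lemma graph_cycles_delete_vertex:
  "graph_cycles G \<subseteq> {c \<in> graph_cycles G. v \<in> fst c} \<union> graph_cycles (delete_vertex G v)"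
proof
  fix c assume c: "c \<in> graph_cycles G"
  obtain vs es where t: "traverses_cycle G vs es" and W: "c = (set vs, set es)"
    using c by (auto simp: graph_cycles_def)
  show "c \<in> {c \<in> graph_cycles G. v \<in> fst c} \<union> graph_cycles (delete_vertex G v)"
  proof (cases "v \<in> set vs")
    case True then show ?thesis using c W by simp
  next
    case False
    have "set vs = \<Union> (ends G ` set es)" using c W cycle_vertices_eq by blast
    then have "traverses_cycle (delete_vertex G v) vs es"
      using t False by (auto simp: traverses_cycle_def delete_vertex_def)
    then show ?thesis using W by (auto simp: graph_cycles_def)
  qed
qed

text \<open>An arbitrary vertex is deleted while the degree bound \<open>D\<close> stays fixed. The
  inequality assumed of \<open>D\<close> is what a vertex of degree 2 requires. Strictness
  originates in the one-vertex graph, which has no cycle while the bound is positive.\<close>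

lemma cycle_number_less:
  fixes A L D :: real
  assumes AL: "A \<ge> 1" "L \<ge> 1" "\<And>d. real d \<le> A * L ^ d"
    and D: "D > 0" "1 / L + 3 / 4 * D / (A * L\<^sup>2) \<le> 3 / 4 * D"
  assumes "multigraph G" "card (vertices G) = Suc k"
    and "\<And>v. v \<in> vertices G \<Longrightarrow> real (vertex_degree G v) \<le> D"
  shows "real (cycle_number G) < 3 / 4 * D * (A ^ k * L ^ card (edges G))"
  using assms(6-)
proof (induction k arbitrary: G)
  case 0
  have "graph_cycles G = {}"
  proof -
    have False if "traverses_cycle G vs es" for vs es
    proof -
      have "card (set vs) \<le> card (vertices G)"
        using that 0(1) by (intro card_mono) (auto simp: traverses_cycle_def multigraph_def)
      then show False using that 0(2) by (auto simp: traverses_cycle_def distinct_card)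
    qed
    then show ?thesis by (auto simp: graph_cycles_def)
  qed
  then show ?case using D AL by (simp add: cycle_number_def)
next
  case (Suc k)
  then obtain v where v: "v \<in> vertices G" by fastforce
  define H where "H = delete_vertex G v"
  define d where "d = vertex_degree G v"
  define X where "X = A ^ Suc k * L ^ card (edges G)"
  have X: "X > 0" using AL by (simp add: X_def)
  have fin: "finite (edges G)" "finite (vertices G)" using Suc.prems by (auto simp: multigraph_def)
  have H: "multigraph H" using Suc.prems(1)
    by (auto simp: H_def delete_vertex_def multigraph_def)
  have Hk: "card (vertices H) = Suc k" using Suc.prems v fin by (simp add: H_def delete_vertex_def)
  have Hdeg: "real (vertex_degree H w) \<le> D" if "w \<in> vertices H" for w
  proof -
    have "vertex_degree H w \<le> vertex_degree G w"
      unfolding vertex_degree_def using fin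
      by (intro card_mono) (auto simp: H_def delete_vertex_def)
    moreover have "w \<in> vertices G" using that by (simp add: H_def delete_vertex_def)
    ultimately show ?thesis using Suc.prems(3)[of w] by linarith
  qed
  have "card (edges G) = card ({e \<in> edges G. v \<in> ends G e} \<union> edges H)"
    by (rule arg_cong[of _ _ card]) (auto simp: H_def delete_vertex_def)
  also have "\<dots> = d + card (edges H)"
    unfolding d_def vertex_degree_def using fin
    by (intro card_Un_disjoint) (auto simp: H_def delete_vertex_def)
  finally have dm: "card (edges G) = d + card (edges H)" .
  have "A ^ k * L ^ card (edges H) = X / (A * L ^ d)"
    using AL by (simp add: X_def dm power_add)
  then have IH: "real (cycle_number H) < 3 / 4 * D * (X / (A * L ^ d))"
    using Suc.IH[OF H Hk Hdeg] by simp
  define t where "t = real (card {c \<in> graph_cycles G. v \<in> fst c})"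
  have "cycle_number G \<le> card ({c \<in> graph_cycles G. v \<in> fst c} \<union> graph_cycles H)"
    unfolding cycle_number_def H_def
    using finite_graph_cycles[OF H] finite_graph_cycles[OF Suc.prems(1)]
    by (intro card_mono graph_cycles_delete_vertex) (auto simp: H_def)
  also have "\<dots> \<le> card {c \<in> graph_cycles G. v \<in> fst c} + cycle_number H"
    unfolding cycle_number_def by (rule card_Un_le)
  finally have C: "real (cycle_number G) \<le> t + real (cycle_number H)" unfolding t_def by linarith
  have tle: "t \<le> real d / 2 * (A ^ Suc k * L ^ (card (edges G) - 1))"
    unfolding t_def d_def by (rule card_cycles_through_vertex_le[OF AL Suc.prems(1,2)])
  have tle': "t \<le> real d / 2 * (X / L)" if "d > 0"
  proof -
    have "L ^ card (edges G) = L * L ^ (card (edges G) - 1)"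
      using that dm by (metis add_gr_0 power_eq_if less_irrefl)
    then show ?thesis using tle AL by (simp add: X_def)
  qed
  have "t + 3 / 4 * D * (X / (A * L ^ d)) \<le> 3 / 4 * D * X"
  proof -
    consider "d \<le> 1" | "d = 2" | "d \<ge> 3" by linarith
    then show ?thesis
    proof cases
      case 1
      have "{c \<in> graph_cycles G. v \<in> fst c} = {}"
      proof (rule ccontr)
        assume "{c \<in> graph_cycles G. v \<in> fst c} \<noteq> {}"
        then obtain W F where c: "(W, F) \<in> graph_cycles G" "v \<in> W" by auto
        obtain e e' where e: "e \<noteq> e'" "e \<in> F" "e' \<in> F" "v \<in> ends G e" "v \<in> ends G e'"
          using cycle_through_vertex[OF c] .
        have "F \<subseteq> edges G" using c by (auto simp: graph_cycles_def traverses_cycle_def)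
        then have "card {e, e'} \<le> d" unfolding d_def vertex_degree_def
          using e fin by (intro card_mono) auto
        then show False using e 1 by simp
      qed
      then have "t = 0" by (metis card.empty of_nat_0 t_def)
      moreover have "1 \<le> A * L ^ d" using AL by (metis mult_mono' one_le_power mult_1 zero_le_one)
      then have "X / (A * L ^ d) \<le> X" using X by (simp add: divide_le_eq mult_le_cancel_left1)
      then have "3 / 4 * D * (X / (A * L ^ d)) \<le> 3 / 4 * D * X"
        using D by (intro mult_left_mono) auto
      ultimately show ?thesis by simp
    next
      case 2
      \<comment> \<open>Deleting a vertex of degree 2 may divide the weight by less than 3. In
        return, \<open>t\<close> is at most \<open>X / L\<close>, and the assumption on
        \<open>D\<close> covers the sum.\<close>
      have "t + 3 / 4 * D * (X / (A * L ^ d)) \<le> X * (1 / L + 3 / 4 * D / (A * L\<^sup>2))"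
        using tle' 2 by (simp add: algebra_simps)
      also have "\<dots> \<le> X * (3 / 4 * D)" using D X by (intro mult_left_mono) auto
      finally show ?thesis by (simp add: mult.commute)
    next
      case 3
      \<comment> \<open>The weight inequality at 3 shows that the weight drops by a factor of at
        least 3, so the two contributions add up as
        \<open>D / 2 + D / 4 = 3 / 4 * D\<close>.\<close>
      have "A * L ^ 3 \<le> A * L ^ d" using 3 AL by (intro mult_left_mono power_increasing) auto
      then have "3 \<le> A * L ^ d" using AL(3)[of 3] by linarith
      then have 1: "X / (A * L ^ d) \<le> X / 3" using X by (intro divide_left_mono) auto
      have "X / L \<le> X" using X AL by (simp add: divide_le_eq)
      then have "real d / 2 * (X / L) \<le> real d / 2 * X" by (intro mult_left_mono) auto
      then have "t \<le> real d / 2 * X" using tle' 3 by linarith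
      also have "\<dots> \<le> D / 2 * X" using Suc.prems(3)[OF v] X by (intro mult_right_mono) (auto simp: d_def)
      finally have "t \<le> D / 2 * X" .
      moreover have "3 / 4 * D * (X / (A * L ^ d)) \<le> 3 / 4 * D * (X / 3)"
        using 1 D by (intro mult_left_mono) auto
      ultimately show ?thesis by (simp add: algebra_simps)
    qed
  qed
  then show ?case using C IH unfolding X_def by linarith
qed

subsection \<open>Cycles with parallel edges\<close>

text \<open>The edge \<open>prod_encode (i, j)\<close> is the \<open>j\<close>-th of the \<open>a i\<close> parallel edges of class \<open>i\<close>. For \<open>k = 2\<close>
  both classes join the vertices 0 and 1, so a choice of one edge from each class is a digon.\<close>

definition thick_cycle :: "nat \<Rightarrow> nat \<Rightarrow> (nat \<Rightarrow> nat) \<Rightarrow> (nat, nat) mgraph" where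
  "thick_cycle n k a =
    \<lparr>vertices = {..<n}, edges = prod_encode ` (SIGMA i:{..<k}. {..<a i}),
     ends = (\<lambda>e. {fst (prod_decode e), Suc (fst (prod_decode e)) mod k})\<rparr>"

lemma multigraph_thick_cycle:
  assumes "2 \<le> k" "k \<le> n" shows "multigraph (thick_cycle n k a)"
proof -
  have "card {i, Suc i mod k} = 2" "Suc i mod k < n" if "i < k" for i
  proof -
    show "card {i, Suc i mod k} = 2"
      using assms that by (cases "Suc i = k") (auto simp: card_insert_if)
    show "Suc i mod k < n"
      using assms by (meson mod_less_divisor less_le_trans zero_less_numeral)
  qed
  then show ?thesis using assms
    by (auto simp: multigraph_def thick_cycle_def)
qed

lemma card_edges_thick_cycle: "card (edges (thick_cycle n k a)) = (\<Sum>i<k. a i)"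
  by (simp add: thick_cycle_def card_image[OF inj_prod_encode])

lemma digon_thick_cycle:
  assumes "2 \<le> k" "k \<le> n" "i < k" "F \<subseteq> prod_encode ` ({i} \<times> {..<a i})" "card F = 2"
  shows "F \<in> snd ` graph_cycles (thick_cycle n k a)"
proof -
  obtain e e' where F: "F = {e, e'}" "e \<noteq> e'" using assms(5) by (auto simp: card_2_iff)
  let ?j = "Suc i mod k"
  have dec: "fst (prod_decode e) = i" "fst (prod_decode e') = i" using assms(4) F by auto
  have "?j < n" using assms by (meson mod_less_divisor less_le_trans zero_less_numeral)
  moreover have "i \<noteq> ?j" using assms by (cases "Suc i = k") auto
  moreover have "F \<subseteq> edges (thick_cycle n k a)"
    using assms(3,4) by (auto simp: thick_cycle_def)
  ultimately have "traverses_cycle (thick_cycle n k a) [i, ?j] [e, e']"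
    using assms F dec by (auto simp: traverses_cycle_def thick_cycle_def less_Suc_eq insert_commute)
  then have "(set [i, ?j], set [e, e']) \<in> graph_cycles (thick_cycle n k a)"
    unfolding graph_cycles_def by blast
  moreover have "F = set [e, e']" using F by simp
  ultimately show ?thesis by (metis image_eqI snd_conv)
qed

lemma transversal_thick_cycle:
  assumes "2 \<le> k" "k \<le> n" "g \<in> (\<Pi>\<^sub>E i\<in>{..<k}. {..<a i})"
  shows "(\<lambda>i. prod_encode (i, g i)) ` {..<k} \<in> snd ` graph_cycles (thick_cycle n k a)"
proof -
  let ?es = "map (\<lambda>i. prod_encode (i, g i)) [0..<k]"
  have "traverses_cycle (thick_cycle n k a) [0..<k] ?es"
    using assms
    by (auto simp: traverses_cycle_def thick_cycle_def distinct_map inj_on_def PiE_iff)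
  then have "(set [0..<k], set ?es) \<in> graph_cycles (thick_cycle n k a)"
    unfolding graph_cycles_def by blast
  moreover have "set ?es = (\<lambda>i. prod_encode (i, g i)) ` {..<k}" by auto
  ultimately show ?thesis by (metis image_eqI snd_conv)
qed

text \<open>Two families of cycles are counted: digons inside one class, and transversals taking one
  edge from every class.\<close>

lemma cycle_number_thick_cycle:
  fixes a :: "nat \<Rightarrow> nat"
  assumes "2 \<le> k" "k \<le> n"
  shows "(\<Sum>i<k. a i choose 2) \<le> cycle_number (thick_cycle n k a)"
    and "3 \<le> k \<Longrightarrow> (\<Prod>i<k. a i) + (\<Sum>i<k. a i choose 2) \<le> cycle_number (thick_cycle n k a)"
proof -
  let ?C = "graph_cycles (thick_cycle n k a)" and ?K = "\<lambda>i. prod_encode ` ({i} \<times> {..<a i})"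
  define P where "P = (\<Pi>\<^sub>E i\<in>{..<k}. {..<a i})"
  define S where "S = (\<Union>i<k. {F. F \<subseteq> ?K i \<and> card F = 2})"
  define T where "T = (\<lambda>g. (\<lambda>i. prod_encode (i, g i)) ` {..<k}) ` P"
  have fin: "finite ?C" using finite_graph_cycles[OF multigraph_thick_cycle[OF assms]] .
  \<comment> \<open>For a lower bound it suffices to count edge sets: projecting cycles to their
    edge sets cannot increase their number.\<close>
  have le: "card (S \<union> T) \<le> cycle_number (thick_cycle n k a)"
  proof -
    have "S \<union> T \<subseteq> snd ` ?C"
      using digon_thick_cycle[OF assms] transversal_thick_cycle[OF assms]
      by (auto simp: S_def T_def P_def)
    then have "card (S \<union> T) \<le> card (snd ` ?C)" using fin by (intro card_mono) auto
    also have "\<dots> \<le> card ?C" using fin by (rule card_image_le)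
    finally show ?thesis by (simp add: cycle_number_def)
  qed
  have finK: "finite (?K i)" for i by simp
  have cardK: "card (?K i) = a i" for i
    by (simp add: card_image[OF inj_prod_encode] card_cartesian_product_singleton)
  have fin2: "finite {F. F \<subseteq> ?K i \<and> card F = 2}" for i
    by (rule finite_subset[of _ "Pow (?K i)"]) auto
  have "card S = (\<Sum>i<k. card {F. F \<subseteq> ?K i \<and> card F = 2})"
    unfolding S_def
  proof (rule card_UN_disjoint)
    show "\<forall>i\<in>{..<k}. finite {F. F \<subseteq> ?K i \<and> card F = 2}" using fin2 by blast
    show "\<forall>i\<in>{..<k}. \<forall>j\<in>{..<k}. i \<noteq> j \<longrightarrow>
        {F. F \<subseteq> ?K i \<and> card F = 2} \<inter> {F. F \<subseteq> ?K j \<and> card F = 2} = {}"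
    proof (intro ballI impI equals0I)
      fix i j :: nat and F
      assume "i \<noteq> j" and F: "F \<in> {F. F \<subseteq> ?K i \<and> card F = 2} \<inter> {F. F \<subseteq> ?K j \<and> card F = 2}"
      then have "?K i \<inter> ?K j = {}" by auto
      then have "F = {}" using F by blast
      then show False using F by simp
    qed
  qed simp
  also have "\<dots> = (\<Sum>i<k. a i choose 2)"
    using n_subsets[OF finK] cardK by simp
  finally have cS: "card S = (\<Sum>i<k. a i choose 2)" .
  have finS: "finite S" unfolding S_def using fin2 by blast
  have finT: "finite T" unfolding T_def P_def by (intro finite_imageI finite_PiE) auto
  show "(\<Sum>i<k. a i choose 2) \<le> cycle_number (thick_cycle n k a)"
    using le card_mono[of "S \<union> T" S] finS finT cS by auto
  assume "3 \<le> k"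
  \<comment> \<open>A transversal has \<open>k\<close> edges, at least three, and a digon has
    two.\<close>
  have "S \<inter> T = {}"
  proof -
    have "card F = k" if "F \<in> T" for F
    proof -
      obtain g where "F = (\<lambda>i. prod_encode (i, g i)) ` {..<k}" using \<open>F \<in> T\<close> by (auto simp: T_def)
      then show ?thesis by (simp add: card_image inj_on_def)
    qed
    then show ?thesis using \<open>3 \<le> k\<close> by (fastforce simp: S_def)
  qed
  then have "card (S \<union> T) = card S + card T" using finS finT by (rule card_Un_disjoint[rotated 2])
  \<comment> \<open>The class index is encoded in each edge, so a transversal edge set determines
    the choice function on \<open>{..<k}\<close>; extensionality fixes it elsewhere.\<close>
  moreover have "card T = card P" unfolding T_def
  proof (intro card_image inj_onI)
    fix g h assume gh: "g \<in> P" "h \<in> P"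
      and eq: "(\<lambda>i. prod_encode (i, g i)) ` {..<k} = (\<lambda>i. prod_encode (i, h i)) ` {..<k}"
    have "g i = h i" if "i < k" for i
    proof -
      have "prod_encode (i, g i) \<in> (\<lambda>i. prod_encode (i, h i)) ` {..<k}"
        using \<open>i < k\<close> unfolding eq[symmetric] by blast
      then show ?thesis by auto
    qed
    then show "g = h" using gh unfolding P_def by (intro PiE_ext) auto
  qed
  ultimately show "(\<Prod>i<k. a i) + (\<Sum>i<k. a i choose 2) \<le> cycle_number (thick_cycle n k a)"
    using le cS by (simp add: P_def card_PiE)
qed

section \<open>Comparing an extremal multigraph with thick cycles\<close>

lemma cycle_maximal_ge:
  assumes "cycle_maximal n m G" "2 \<le> k" "k \<le> n" "(\<Sum>i<k. a i) = m"
  shows "(\<Sum>i<k. a i choose 2) \<le> cycle_number G"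
    and "3 \<le> k \<Longrightarrow> (\<Prod>i<k. a i) + (\<Sum>i<k. a i choose 2) \<le> cycle_number G"
proof -
  have "multigraph H \<and> card (vertices H) = n \<and> card (edges H) = m \<longrightarrow>
      cycle_number H \<le> cycle_number G" for H :: "(nat, nat) mgraph"
    using assms(1) by (simp add: cycle_maximal_def)
  moreover have "card (vertices (thick_cycle n k a)) = n" by (simp add: thick_cycle_def)
  ultimately have "cycle_number (thick_cycle n k a) \<le> cycle_number G"
    using assms(4) multigraph_thick_cycle[OF assms(2,3)] card_edges_thick_cycle[of n k a] by simp
  then show "(\<Sum>i<k. a i choose 2) \<le> cycle_number G"
    and "3 \<le> k \<Longrightarrow> (\<Prod>i<k. a i) + (\<Sum>i<k. a i choose 2) \<le> cycle_number G"
    using cycle_number_thick_cycle[OF assms(2,3), of a] by linarith+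
qed

text \<open>The competitor puts all edges in parallel between two vertices, so that any two of them
  form a digon. This serves when there are only two vertices or few edges.\<close>

lemma cycle_maximal_ge_choose:
  assumes "cycle_maximal n m G" "2 \<le> n"
  shows "m choose 2 \<le> cycle_number G"
proof -
  have "{..<2} = {0, 1::nat}" by auto
  then show ?thesis
    using cycle_maximal_ge(1)[OF assms(1), of 2 "\<lambda>i. if i = 0 then m else 0"] assms(2) by simp
qed

text \<open>Edges taken from three classes of size \<open>S\<close> of a path form a further class that closes the path
  to a cycle; the constant 8/27 is attained at \<open>S = 3\<close>.\<close>

lemma closing_class:
  assumes "S \<ge> 3"
  obtains c0 c1 c2 :: nat where "c0 \<le> S" "c1 \<le> S" "c2 \<le> S"
    "8 * S ^ 4 \<le> 27 * ((S - c0) * (S - c1) * (S - c2) * (c0 + c1 + c2))"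
proof -
  \<comment> \<open>Over the reals \<open>(S - c) ^ 3 * (3 * c)\<close> is largest at
    \<open>c = S / 4\<close>; the witnesses round this according to the residue of \<open>S\<close>
    modulo 4.\<close>
  define q where "q = S div 4"
  have "S = 4 * q + S mod 4" "S mod 4 < 4" by (simp_all add: q_def)
  then consider "S = 4 * q" | "S = 4 * q + 1" | "S = 4 * q + 2" | "S = 4 * q + 3" by linarith
  then show ?thesis
  proof cases
    case 1
    show ?thesis
      by (rule that[of q q q]) (auto simp: 1 power4_eq_xxxx)
  next
    case 2
    \<comment> \<open>Since \<open>S \<ge> 3\<close> and the residue is 1, \<open>q\<close> is
      positive. In terms of \<open>p\<close> no truncated subtraction remains, and polynomials with
      natural coefficients can be compared.\<close>
    then obtain p where "q = Suc p" using assms by (cases q) auto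
    then have "S = 4 * p + 5" "S - Suc p = 3 * p + 4" using 2 by auto
    then show ?thesis
      by (intro that[of "Suc p" "Suc p" "Suc p"]) (auto simp: power4_eq_xxxx algebra_simps)
  next
    case 3
    then obtain p where "q = Suc p" using assms by (cases q) auto
    then have "S = 4 * p + 6" "S - Suc p = 3 * p + 5" "S - (p + 2) = 3 * p + 4" using 3 by auto
    then show ?thesis
      by (intro that[of "Suc p" "Suc p" "p + 2"]) (auto simp: power4_eq_xxxx algebra_simps)
  next
    case 4
    then have "S - q = 3 * q + 3" "S - Suc q = 3 * q + 2" by auto
    then show ?thesis using 4
      by (intro that[of q "Suc q" "Suc q"]) (auto simp: power4_eq_xxxx algebra_simps)
  qed
qed

subsection \<open>Arithmetic of class sizes\<close>

lemma prod_lessThan_if: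
  fixes x y :: nat
  assumes "r \<le> k"
  shows "(\<Prod>i<k. if i < r then x else y) = x ^ r * y ^ (k - r)"
proof -
  have "{..<k} \<inter> {i. i < r} = {..<r}" "{..<k} \<inter> - {i. i < r} = {r..<k}" using assms by auto
  then show ?thesis by (simp add: prod.If_cases)
qed

lemma sum_lessThan_if:
  assumes "r \<le> k"
  shows "(\<Sum>i<k. if i < r then Suc y else y) = k * y + r"
proof -
  have "(\<Sum>i<k. if i < r then Suc y else y) = (\<Sum>i<k. y + (if i < r then 1 else 0))"
    by (intro sum.cong) auto
  also have "\<dots> = k * y + card ({..<k} \<inter> {i. i < r})" by (simp add: sum.distrib sum.If_cases)
  also have "{..<k} \<inter> {i. i < r} = {..<r}" using assms by auto
  finally show ?thesis by simp
qed

text \<open>Taking \<open>c\<close> edges from a class of size \<open>x \<ge> S\<close> loses no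
  larger a proportion than from one of size \<open>S\<close>. This carries
  \<open>closing_class\<close> over to the larger classes.\<close>

lemma diff_ge_proportional:
  fixes S x c :: nat
  assumes "S \<le> x" shows "x * (S - c) \<le> S * (x - c)"
proof (cases "c \<le> S")
  case True
  then have "x * (S - c) = x * S - x * c" "S * (x - c) = x * S - S * c"
    by (simp_all add: diff_mult_distrib2 mult.commute)
  then show ?thesis using assms by (simp add: diff_le_mono2)
qed simp

lemma sum_lessThan_3_add:
  fixes f :: "nat \<Rightarrow> 'a :: comm_monoid_add"
  shows "(\<Sum>i<Suc (Suc (Suc N)). f i) = f 0 + (f 1 + (f 2 + (\<Sum>i<N. f (Suc (Suc (Suc i))))))"
  by (simp only: sum.lessThan_Suc_shift One_nat_def numeral_2_eq_2)

lemma prod_lessThan_3_mult: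
  fixes f :: "nat \<Rightarrow> 'a :: comm_monoid_mult"
  shows "(\<Prod>i<Suc (Suc (Suc N)). f i) = f 0 * (f 1 * (f 2 * (\<Prod>i<N. f (Suc (Suc (Suc i))))))"
  by (simp only: prod.lessThan_Suc_shift One_nat_def numeral_2_eq_2)

text \<open>The \<open>b i\<close> are the classes of a path with \<open>k\<close> steps. Thinning
  the first three and using the removed edges as class \<open>k\<close> closes the path, keeps the
  total and multiplies the product by at least \<open>8 * S / 27\<close>.\<close>

lemma closed_path_classes:
  fixes b :: "nat \<Rightarrow> nat"
  assumes "S \<ge> 3" "k \<ge> 3" "\<And>i. S \<le> b i"
  obtains a where "(\<Sum>i<Suc k. a i) = (\<Sum>i<k. b i)"
    "8 * S * (\<Prod>i<k. b i) \<le> 27 * (\<Prod>i<Suc k. a i)"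
proof -
  obtain c0 c1 c2 where c: "c0 \<le> S" "c1 \<le> S" "c2 \<le> S"
    "8 * S ^ 4 \<le> 27 * ((S - c0) * (S - c1) * (S - c2) * (c0 + c1 + c2))"
    using closing_class[OF assms(1)] .
  obtain N where k: "k = Suc (Suc (Suc N))"
    using assms(2) by (metis add.commute le_Suc_ex numeral_3_eq_3 add_Suc_right add_0_right)
  define a where "a = b(0 := b 0 - c0, 1 := b 1 - c1, 2 := b 2 - c2, k := c0 + c1 + c2)"
  define R where "R = (\<Prod>i<N. b (Suc (Suc (Suc i))))"
  have aR: "a (Suc (Suc (Suc i))) = b (Suc (Suc (Suc i)))" if "i < N" for i
    using that by (simp add: a_def k)
  have a: "a 0 = b 0 - c0" "a 1 = b 1 - c1" "a 2 = b 2 - c2" "a k = c0 + c1 + c2"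
    by (simp_all add: a_def k)
  have sumR: "(\<Sum>i<N. a (Suc (Suc (Suc i)))) = (\<Sum>i<N. b (Suc (Suc (Suc i))))"
    and prodR: "(\<Prod>i<N. a (Suc (Suc (Suc i)))) = R"
    using aR by (simp_all add: R_def)
  have suma: "(\<Sum>i<k. a i) = a 0 + (a 1 + (a 2 + (\<Sum>i<N. b (Suc (Suc (Suc i))))))"
    unfolding k sum_lessThan_3_add sumR ..
  have proda: "(\<Prod>i<k. a i) = a 0 * (a 1 * (a 2 * R))"
    unfolding k prod_lessThan_3_mult prodR ..
  have sumb: "(\<Sum>i<k. b i) = b 0 + (b 1 + (b 2 + (\<Sum>i<N. b (Suc (Suc (Suc i))))))"
    unfolding k by (rule sum_lessThan_3_add)
  have prodb: "(\<Prod>i<k. b i) = b 0 * (b 1 * (b 2 * R))"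
    unfolding k R_def by (rule prod_lessThan_3_mult)
  show ?thesis
  proof
    have "c0 \<le> b 0" "c1 \<le> b 1" "c2 \<le> b 2" using c assms(3) le_trans by blast+
    then show "(\<Sum>i<Suc k. a i) = (\<Sum>i<k. b i)"
      unfolding sum.lessThan_Suc suma sumb a by linarith
    \<comment> \<open>Multiplying by \<open>S ^ 3\<close> avoids division: each
      \<open>b i * (S - c)\<close> can then be exchanged for \<open>S * (b i - c)\<close>.\<close>
    have "S ^ 3 * (8 * S * (\<Prod>i<k. b i)) = (8 * S ^ 4) * (b 0 * b 1 * b 2 * R)"
      unfolding prodb by (simp add: power4_eq_xxxx power3_eq_cube)
    also have "\<dots> \<le> 27 * ((S - c0) * (S - c1) * (S - c2) * (c0 + c1 + c2)) * (b 0 * b 1 * b 2 * R)"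
      using c by (intro mult_right_mono) auto
    also have "\<dots> = 27 * ((b 0 * (S - c0)) * (b 1 * (S - c1)) * (b 2 * (S - c2))) * (R * (c0 + c1 + c2))"
      by (simp add: mult_ac)
    also have "\<dots> \<le> 27 * ((S * (b 0 - c0)) * (S * (b 1 - c1)) * (S * (b 2 - c2))) * (R * (c0 + c1 + c2))"
      using assms(3) by (intro mult_le_mono diff_ge_proportional) auto
    also have "\<dots> = S ^ 3 * (27 * (\<Prod>i<Suc k. a i))"
      unfolding prod.lessThan_Suc proda a by (simp add: power3_eq_cube mult_ac)
    finally show "8 * S * (\<Prod>i<k. b i) \<le> 27 * (\<Prod>i<Suc k. a i)"
      using assms(1) by (subst (asm) nat_mult_le_cancel1) auto
  qed
qed

section \<open>Lower bound when the average class size is at least 3\<close>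

lemma two_choose_two: "2 * (x choose 2) = x * (x - 1)"
proof -
  have "even (x * (x - 1))" by (cases x) auto
  then show ?thesis by (simp add: choose_two)
qed

text \<open>On three vertices the spanning path has only two classes, too few for
  \<open>closed_path_classes\<close>. Balanced triangle classes have a product close to
  \<open>(m / 3) ^ 3\<close>, and the digons make up for the rounding.\<close>

lemma balanced_triangle:
  fixes m :: nat
  assumes "m \<ge> 6"
  obtains a where "(\<Sum>i<3::nat. a i) = m" "m ^ 3 \<le> 27 * ((\<Prod>i<3. a i) + (\<Sum>i<3. a i choose 2))"
proof -
  define q where "q = m div 3"
  define a where "a = (\<lambda>i::nat. if i < m mod 3 then Suc q else q)"
  have m: "m = 3 * q + m mod 3" "m mod 3 < 3" by (simp_all add: q_def)
  then have q: "q \<ge> 2" using assms by linarith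
  \<comment> \<open>The right side is \<open>q ^ 2\<close>. So \<open>2 * (q choose 2)\<close> is at
    least \<open>q\<close>, enough to absorb the rounding losses \<open>9 * q + 1\<close> and
    \<open>9 * q + 8\<close> below.\<close>
  have choose: "2 * q \<le> 2 * (q choose 2) + q"
    using q unfolding two_choose_two by (cases q) auto
  have sum: "(\<Sum>i<3. a i) = m" unfolding a_def using m by (subst sum_lessThan_if) auto
  have prod: "(\<Prod>i<3. a i) = Suc q ^ (m mod 3) * q ^ (3 - m mod 3)"
    unfolding a_def using m by (subst prod_lessThan_if) auto
  have "3 * (q choose 2) = (\<Sum>i<3::nat. q choose 2)" by simp
  also have "\<dots> \<le> (\<Sum>i<3. a i choose 2)"
    by (intro sum_mono) (auto simp: a_def numeral_2_eq_2)
  finally have ch: "3 * (q choose 2) \<le> (\<Sum>i<3. a i choose 2)" .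
  have "m ^ 3 \<le> 27 * ((\<Prod>i<3. a i) + 3 * (q choose 2))"
  proof -
    consider "m mod 3 = 0" | "m mod 3 = 1" | "m mod 3 = 2" using m by linarith
    then show ?thesis
    proof cases
      case 1 then show ?thesis using m prod by (simp add: power3_eq_cube)
    next
      case 2
      then have "m ^ 3 = 27 * (Suc q * q ^ 2) + (9 * q + 1)" using m
        by (simp add: power3_eq_cube power2_eq_square algebra_simps)
      then show ?thesis using prod 2 choose q by simp
    next
      case 3
      then have "m ^ 3 = 27 * (Suc q ^ 2 * q) + (9 * q + 8)" using m
        by (simp add: power3_eq_cube power2_eq_square algebra_simps)
      then show ?thesis using prod 3 choose q by simp
    qed
  qed
  also have "\<dots> \<le> 27 * ((\<Prod>i<3. a i) + (\<Sum>i<3. a i choose 2))" using ch by simp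
  finally show ?thesis using that[of a] sum by blast
qed

lemma cycle_maximal_ge_dense:
  assumes "cycle_maximal n m G" "n \<ge> 2" "m = (n - 1) * S + r" "r < n - 1" "S \<ge> 3"
  shows "8 * S * (Suc S ^ r * S ^ (n - 1 - r)) \<le> 27 * cycle_number G"
proof -
  consider "n = 2" | "n = 3" | "n \<ge> 4" using assms(2) by linarith
  then show ?thesis
  proof cases
    case 1
    have "8 * S * S \<le> 27 * (S choose 2)"
    proof -
      have "16 * S \<le> 27 * (S - 1)" using assms(5) by simp
      then have "16 * S * S \<le> 27 * (S - 1) * S" by (rule mult_le_mono1)
      then show ?thesis using two_choose_two[of S] by (simp add: algebra_simps)
    qed
    then show ?thesis using cycle_maximal_ge_choose[OF assms(1,2)] assms 1 by simp
  next
    case 2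
    then have "m \<ge> 6" using assms by simp
    then obtain a where a: "(\<Sum>i<3::nat. a i) = m"
      "m ^ 3 \<le> 27 * ((\<Prod>i<3. a i) + (\<Sum>i<3. a i choose 2))"
      by (rule balanced_triangle)
    have "r = 0 \<or> r = 1" using assms 2 by auto
    \<comment> \<open>Here \<open>m = 2 * S + r\<close>. For \<open>r = 0\<close> both sides equal
      \<open>8 * S ^ 3\<close>; for \<open>r = 1\<close> the cube has the larger lower-order
      terms.\<close>
    then have "8 * S * (Suc S ^ r * S ^ (n - 1 - r)) \<le> m ^ 3"
      using assms(3) 2 by (auto simp: power3_eq_cube power2_eq_square algebra_simps)
    also have "\<dots> \<le> 27 * cycle_number G"
      using cycle_maximal_ge(2)[OF assms(1) _ _ a(1)] a(2) 2 by simp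
    finally show ?thesis .
  next
    case 3
    define b where "b = (\<lambda>i. if i < r then Suc S else S)"
    obtain a where a: "(\<Sum>i<Suc (n - 1). a i) = (\<Sum>i<n - 1. b i)"
      "8 * S * (\<Prod>i<n - 1. b i) \<le> 27 * (\<Prod>i<Suc (n - 1). a i)"
    proof (rule closed_path_classes[of S "n - 1" b])
      show "3 \<le> n - 1" using 3 by simp
    qed (use assms(5) in \<open>auto simp: b_def\<close>)
    have n: "Suc (n - 1) = n" using 3 by simp
    have "(\<Sum>i<n - 1. b i) = m" unfolding b_def using assms by (subst sum_lessThan_if) auto
    moreover have "(\<Prod>i<n - 1. b i) = Suc S ^ r * S ^ (n - 1 - r)"
      unfolding b_def using assms by (subst prod_lessThan_if) auto
    ultimately show ?thesis
      using cycle_maximal_ge(2)[OF assms(1), of n a] a[unfolded n] 3 by simp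
  qed
qed

section \<open>The cube root of 3 and the lower bound for average class size at most 3\<close>

lemma cycle_maximal_ge_sparse:
  assumes "cycle_maximal n (3 * K + x) G" "2 \<le> K" "K < n"
  shows "3 ^ K * x \<le> cycle_number G"
proof -
  define a where "a = (\<lambda>i. if i < K then 3 else x)"
  have "(\<Sum>i<Suc K. a i) = 3 * K + x" "(\<Prod>i<Suc K. a i) = 3 ^ K * x" by (simp_all add: a_def)
  then show ?thesis using cycle_maximal_ge(2)[OF assms(1), of "Suc K" a] assms(2,3) by simp
qed

text \<open>The bound 1.44 has a square above 2 and a triple above 4, as small degrees need; 1.5
  gives \<open>4 * 1.5 ^ 2 = 9\<close> and \<open>4 * 1.5 = 6\<close>, exactly what the residue
  classes of \<open>m\<close> need.\<close>

lemma root_3_3_bounds: "root 3 3 ^ 3 = (3::real)" "1.44 \<le> root 3 (3::real)" "root 3 (3::real) \<le> 1.5"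
proof -
  show 1: "root 3 3 ^ 3 = (3::real)" by simp
  have "root 3 (1.44 ^ 3) \<le> root 3 (3::real)" by (intro real_root_le_mono) (auto simp: power3_eq_cube)
  then show "1.44 \<le> root 3 (3::real)" by (subst (asm) real_root_power_cancel) auto
  have "root 3 3 \<le> root 3 (1.5 ^ 3 :: real)" by (intro real_root_le_mono) (auto simp: power3_eq_cube)
  then show "root 3 (3::real) \<le> 1.5" by (subst (asm) real_root_power_cancel) auto
qed

text \<open>Among positive integers the \<open>d\<close>-th root of \<open>d\<close> is largest at
  3. Passing from \<open>d - 3\<close> to \<open>d\<close> multiplies the right side by 3, whereas
  the left side at most triples once \<open>d \<ge> 5\<close>.\<close>

lemma le_root_3_3_power: "real d \<le> root 3 3 ^ d"
proof (induction d rule: less_induct)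
  case (less d)
  let ?L = "root 3 3 :: real"
  have sq: "?L\<^sup>2 \<ge> 2" using mult_mono[OF root_3_3_bounds(2) root_3_3_bounds(2)]
    by (simp add: power2_eq_square)
  consider "d = 0" | "d = 1" | "d = 2" | "d = 3" | "d = 4" | "d \<ge> 5" by linarith
  then show ?case
  proof cases
    case 5
    have "?L ^ 4 = 3 * ?L" using root_3_3_bounds(1) by (simp add: eval_nat_numeral)
    then show ?thesis using 5 root_3_3_bounds(2) by simp
  next
    case 6
    define e where "e = d - 3"
    have e: "d = e + 3" "e \<ge> 2" using 6 by (simp_all add: e_def)
    have "real d \<le> 3 * real e" using e by simp
    also have "\<dots> \<le> 3 * ?L ^ e" using less[of e] e by simp
    also have "\<dots> = ?L ^ d" using root_3_3_bounds(1) by (simp add: e power_add)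
    finally show ?thesis .
  qed (use sq root_3_3_bounds in auto)
qed

lemma cycle_maximal_ge_root_3_3:
  assumes "cycle_maximal n m G" "n \<ge> 2" "m \<ge> 3" "m \<le> 3 * (n - 1)"
  shows "4 * root 3 3 powi (int m - 4) \<le> real (cycle_number G)"
proof -
  let ?L = "root 3 3 :: real"
  have L: "?L ^ 3 = 3" "1.44 \<le> ?L" "?L \<le> 1.5" by (fact root_3_3_bounds)+
  have sq: "4 * ?L\<^sup>2 \<le> 9" using mult_mono[OF L(3) L(3)] by (simp add: power2_eq_square)
  have choose: "real (m choose 2) \<le> real (cycle_number G)"
    using cycle_maximal_ge_choose[OF assms(1,2)] by simp
  have powi: "?L powi (int m - 4) = ?L ^ (m - 4)" if "m \<ge> 4"
  proof -
    have "int m - 4 = int (m - 4)" using that by simp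
    then show ?thesis by (simp only: power_int_of_nat)
  qed
  consider "m = 3" | "m = 4" | "m = 5" | "m = 6" | "m = 7" | "m \<ge> 8" using assms(3) by linarith
  then show ?thesis
  proof cases
    \<comment> \<open>The exponent is -1 here, which is why an integer power is used.\<close>
    case 1
    have "4 / ?L \<le> 3" using L by (simp add: divide_le_eq)
    then show ?thesis using choose 1 by (simp add: choose_two power_int_minus divide_inverse)
  next
    case 2 then show ?thesis using choose by (simp add: choose_two)
  next
    case 3 then show ?thesis using choose L by (simp add: choose_two)
  next
    case 4 then show ?thesis using choose sq powi by (simp add: choose_two)
  next
    case 5 then show ?thesis using choose L powi by (simp add: choose_two)
  next
    \<comment> \<open>From 8 edges on there are at least two classes of size 3 besides the last one,
      so a genuine cycle of three or more classes arises. The last class has size 3, 4 or 2 as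
      \<open>m mod 3\<close> is 0, 1 or 2, and \<open>m \<le> 3 * (n - 1)\<close> leaves enough
      vertices.\<close>
    case 6
    have pow: "?L ^ (3 * i + j) = 3 ^ i * ?L ^ j" for i j
      using L(1) by (simp add: power_add power_mult)
    define k where "k = m div 3"
    have m: "m = 3 * k + m mod 3" "m mod 3 < 3" by (simp_all add: k_def)
    have "4 * ?L ^ (m - 4) \<le> real (cycle_number G)"
    proof -
      consider "m mod 3 = 0" | "m mod 3 = 1" | "m mod 3 = 2" using m by linarith
      then show ?thesis
      proof cases
        case 1
        define i where "i = k - 2"
        have i: "m = 3 * Suc i + 3" "m - 4 = 3 * i + 2" "2 \<le> Suc i" "Suc i < n"
          using m 1 6 assms(4) by (auto simp: i_def)
        then have "real (3 ^ Suc i * 3) \<le> real (cycle_number G)"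
          using cycle_maximal_ge_sparse[of n "Suc i" 3 G] assms(1)
          by (simp del: of_nat_mult of_nat_power power_Suc)
        moreover have "4 * ?L ^ (m - 4) = 3 ^ i * (4 * ?L\<^sup>2)" unfolding i(2) pow by simp
        then have "4 * ?L ^ (m - 4) \<le> 3 ^ i * 9" using sq by simp
        ultimately show ?thesis by simp
      next
        case 2
        define i where "i = k - 2"
        have i: "m = 3 * Suc i + 4" "m - 4 = 3 * i + 3" "2 \<le> Suc i" "Suc i < n"
          using m 2 6 assms(4) by (auto simp: i_def)
        then have "real (3 ^ Suc i * 4) \<le> real (cycle_number G)"
          using cycle_maximal_ge_sparse[of n "Suc i" 4 G] assms(1)
          by (simp del: of_nat_mult of_nat_power power_Suc)
        moreover have "4 * ?L ^ (m - 4) = 3 ^ i * 12" unfolding i(2) pow L(1) by simp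
        ultimately show ?thesis by simp
      next
        case 3
        define i where "i = k - 1"
        have i: "m = 3 * Suc i + 2" "m - 4 = 3 * i + 1" "2 \<le> Suc i" "Suc i < n"
          using m 3 6 assms(4) by (auto simp: i_def)
        then have "real (3 ^ Suc i * 2) \<le> real (cycle_number G)"
          using cycle_maximal_ge_sparse[of n "Suc i" 2 G] assms(1)
          by (simp del: of_nat_mult of_nat_power power_Suc)
        moreover have "4 * ?L ^ (m - 4) = 3 ^ i * (4 * ?L)" unfolding i(2) pow by simp
        then have "4 * ?L ^ (m - 4) \<le> 3 ^ i * 6" using L(3) by simp
        ultimately show ?thesis by simp
      qed
    qed
    then show ?thesis using powi 6 by simp
  qed
qed

subsection \<open>Choice of the weights\<close>

lemma sum_vertex_degree:
  assumes "multigraph G"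
  shows "(\<Sum>v\<in>vertices G. vertex_degree G v) = 2 * card (edges G)"
proof -
  have fin: "finite (vertices G)" "finite (edges G)"
    and ends: "\<And>e. e \<in> edges G \<Longrightarrow> ends G e \<subseteq> vertices G \<and> card (ends G e) = 2"
    using assms by (auto simp: multigraph_def)
  have "(\<Sum>v\<in>vertices G. vertex_degree G v) = (\<Sum>e\<in>edges G. card {v \<in> vertices G. v \<in> ends G e})"
    using sum.swap_restrict[OF fin, of "\<lambda>_ _. 1::nat" "\<lambda>v e. v \<in> ends G e"]
    by (simp add: vertex_degree_def)
  also have "\<dots> = (\<Sum>e\<in>edges G. 2)"
  proof (rule sum.cong)
    fix e assume "e \<in> edges G"
    moreover have "{v \<in> vertices G. v \<in> ends G e} = ends G e" using ends[OF \<open>e \<in> edges G\<close>] by auto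
    ultimately show "card {v \<in> vertices G. v \<in> ends G e} = 2" using ends by simp
  qed simp
  finally show ?thesis by simp
qed

lemma vertex_degree_le_max_degree:
  "multigraph G \<Longrightarrow> v \<in> vertices G \<Longrightarrow> vertex_degree G v \<le> max_degree G"
  by (simp add: max_degree_def multigraph_def)

text \<open>The handshake identity; it later forces maximum degree at least 3 in the dense
  case.\<close>

lemma two_card_edges_le:
  assumes "multigraph G" shows "2 * card (edges G) \<le> card (vertices G) * max_degree G"
proof -
  have "(\<Sum>v\<in>vertices G. vertex_degree G v) \<le> (\<Sum>v\<in>vertices G. max_degree G)"
    by (intro sum_mono vertex_degree_le_max_degree assms)
  then show ?thesis by (simp add: sum_vertex_degree[OF assms])
qed

lemma max_degree_ge_2:
  assumes "multigraph G" "graph_cycles G \<noteq> {}" shows "2 \<le> max_degree G"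
proof -
  obtain W F where c: "(W, F) \<in> graph_cycles G" using assms(2) by auto
  then have "W \<subseteq> vertices G" "W \<noteq> {}" by (auto simp: graph_cycles_def traverses_cycle_def)
  then obtain v where v: "v \<in> W" "v \<in> vertices G" by blast
  obtain e e' where e: "e \<noteq> e'" "e \<in> F" "e' \<in> F" "v \<in> ends G e" "v \<in> ends G e'"
    using cycle_through_vertex[OF c v(1)] .
  have "F \<subseteq> edges G" using c by (auto simp: graph_cycles_def traverses_cycle_def)
  then have "card {e, e'} \<le> vertex_degree G v"
    unfolding vertex_degree_def using e assms(1) by (intro card_mono) (auto simp: multigraph_def)
  then show ?thesis using e(1) vertex_degree_le_max_degree[OF assms(1) v(2)] by simp
qed

lemma cycle_number_less_root_3_3:
  assumes "multigraph G" "vertices G \<noteq> {}" "2 \<le> max_degree G"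
  shows "real (cycle_number G) < 3 / 4 * real (max_degree G) * root 3 3 ^ card (edges G)"
proof -
  let ?L = "root 3 3 :: real" and ?D = "real (max_degree G)"
  have L: "1.44 \<le> ?L" "?L \<le> 1.5" by (fact root_3_3_bounds)+
  have sq: "2 \<le> ?L\<^sup>2" using mult_mono[OF L(1) L(1)] by (simp add: power2_eq_square)
  \<comment> \<open>The coefficient 1.16 makes the linear term of the product equal to
    \<open>- ?L\<close>. Its constant term is below -3/2, which leaves the quadratic inequality
    needed for \<open>D\<close> at degree 2.\<close>
  have "0 \<le> (?L - 1.44) * (1.5 * ?L + 1.16)" using L by (intro mult_nonneg_nonneg) auto
  then have "?L \<le> 3 / 2 * (?L\<^sup>2 - 1)" using L by (simp add: power2_eq_square algebra_simps)
  also have "\<dots> \<le> 3 / 4 * ?D * (?L\<^sup>2 - 1)" using assms(3) sq by (intro mult_right_mono) auto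
  finally have "?L / ?L\<^sup>2 \<le> 3 / 4 * ?D * (?L\<^sup>2 - 1) / ?L\<^sup>2" by (intro divide_right_mono) auto
  moreover have "?L / ?L\<^sup>2 = 1 / ?L" by (simp add: power2_eq_square)
  moreover have "3 / 4 * ?D * (?L\<^sup>2 - 1) / ?L\<^sup>2 = 3 / 4 * ?D - 3 / 4 * ?D / (1 * ?L\<^sup>2)"
    using L by (simp add: field_simps)
  ultimately have D: "1 / ?L + 3 / 4 * ?D / (1 * ?L\<^sup>2) \<le> 3 / 4 * ?D" by linarith
  have "card (vertices G) > 0" using assms by (simp add: multigraph_def card_gt_0_iff)
  then have "real (cycle_number G) < 3 / 4 * ?D * (1 ^ (card (vertices G) - 1) * ?L ^ card (edges G))"
    using assms L by (intro cycle_number_less[OF _ _ _ _ D])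
      (auto intro: le_root_3_3_power vertex_degree_le_max_degree)
  then show ?thesis by simp
qed

text \<open>The right side is convex in \<open>d\<close> and meets the identity at \<open>S\<close>
  and \<open>S + 1\<close>, so it lies above the identity at every integer. Bernoulli's inequality
  shows this on either side of \<open>S\<close>.\<close>

lemma le_geometric_weight:
  fixes S d :: nat
  assumes "S \<ge> 1"
  defines "x \<equiv> real S"
  shows "real d \<le> x * (x / (x + 1)) ^ S * ((x + 1) / x) ^ d"
proof (cases "S \<le> d")
  case True
  have x: "x > 0" using assms by simp
  obtain j where d: "d = S + j" using True le_Suc_ex by blast
  have inv: "(x / (x + 1)) ^ S * ((x + 1) / x) ^ S = 1"
    using x by (simp flip: power_mult_distrib)
  have "- 1 \<le> 1 / x" using x by (simp add: le_divide_eq)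
  then have "x * (1 + real j * (1 / x)) \<le> x * (1 + 1 / x) ^ j"
    using x by (intro mult_left_mono Bernoulli_inequality) auto
  moreover have "x * (1 + real j * (1 / x)) = real d" using x by (simp add: d x_def field_simps)
  moreover have "1 + 1 / x = (x + 1) / x" using x by (simp add: field_simps)
  ultimately have "real d \<le> x * ((x + 1) / x) ^ j" by simp
  also have "\<dots> = x * ((x / (x + 1)) ^ S * ((x + 1) / x) ^ S) * ((x + 1) / x) ^ j"
    by (simp only: inv mult_1_right)
  finally show ?thesis by (simp only: d power_add mult.assoc)
next
  case False
  have x: "x > 0" using assms by simp
  obtain j where S: "S = d + j" using False le_Suc_ex by (metis nat_le_linear)
  have inv: "(x / (x + 1)) ^ d * ((x + 1) / x) ^ d = 1"
    using x by (simp flip: power_mult_distrib)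
  \<comment> \<open>To the left of \<open>S\<close> the step ratio is
    \<open>1 - 1 / (x + 1)\<close>, so Bernoulli is applied with a negative increment.\<close>
  have "x * (1 + real j * (- 1 / (x + 1))) \<le> x * (1 + - 1 / (x + 1)) ^ j"
    using x by (intro mult_left_mono Bernoulli_inequality) (auto simp: field_simps)
  moreover have "real d \<le> x * (1 + real j * (- 1 / (x + 1)))"
    using x S by (simp add: x_def field_simps)
  moreover have "1 + - 1 / (x + 1) = x / (x + 1)" using x by (simp add: field_simps)
  ultimately have "real d \<le> x * (x / (x + 1)) ^ j" by simp
  also have "\<dots> = x * (x / (x + 1)) ^ j * ((x / (x + 1)) ^ d * ((x + 1) / x) ^ d)"
    by (simp only: inv mult_1_right)
  also have "\<dots> = x * (x / (x + 1)) ^ (d + j) * ((x + 1) / x) ^ d"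
    by (simp only: power_add mult_ac)
  finally show ?thesis by (simp only: S[symmetric])
qed

text \<open>It amounts to \<open>(1 + 1 / S) ^ S \<le> S\<close>, which follows since the left side
  is at most e, hence at most 3.\<close>

lemma one_le_geometric_weight:
  fixes S :: nat
  assumes "S \<ge> 3" shows "1 \<le> real S * (real S / (real S + 1)) ^ S"
proof -
  have "(1 + 1 / real S) ^ S \<le> exp (1 / real S) ^ S" by (intro power_mono) auto
  also have "\<dots> = exp 1" using assms by (simp flip: exp_of_nat_mult)
  also have "\<dots> \<le> 3" by (rule exp_le)
  finally have "(1 + 1 / real S) ^ S \<le> S" using assms by linarith
  moreover have "(1 + 1 / real S) ^ S > 0" by (intro zero_less_power add_pos_nonneg) auto
  ultimately have "1 \<le> real S / (1 + 1 / real S) ^ S" by (simp only: le_divide_eq_1_pos)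
  also have "\<dots> = real S * (1 / (1 + 1 / real S)) ^ S" by (simp add: power_one_over)
  also have "1 / (1 + 1 / real S) = real S / (real S + 1)" using assms by (simp add: field_simps)
  finally show ?thesis .
qed

lemma cycle_number_less_dense:
  assumes "multigraph G" "card (vertices G) = Suc k" "card (edges G) = k * S + r" "r \<le> k"
    and "3 \<le> S" "3 \<le> max_degree G"
  shows "real (cycle_number G) < 3 / 4 * real (max_degree G) * (real (Suc S) ^ r * real S ^ (k - r))"
proof -
  define A L where "A = real S * (real S / (real S + 1)) ^ S" and "L = (real S + 1) / real S"
  let ?D = "real (max_degree G)"
  have AL: "A \<ge> 1" "L \<ge> 1" "\<And>d. real d \<le> A * L ^ d"
    unfolding A_def L_def
  proof -
    show "1 \<le> real S * (real S / (real S + 1)) ^ S" by (rule one_le_geometric_weight[OF assms(5)])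
    show "1 \<le> (real S + 1) / real S" using assms(5) by simp
    show "real d \<le> real S * (real S / (real S + 1)) ^ S * ((real S + 1) / real S) ^ d" for d
      using assms(5) by (intro le_geometric_weight) simp
  qed
  \<comment> \<open>With \<open>A * L ^ 2\<close> at least 2, the degree 2 condition reduces to
    \<open>1 + 3 / 8 * ?D \<le> 3 / 4 * ?D\<close>, which holds from \<open>?D = 3\<close>
    on.\<close>
  have "2 \<le> A * L\<^sup>2" using AL(3)[of 2] by simp
  then have "3 / 4 * ?D / (A * L\<^sup>2) \<le> 3 / 4 * ?D / 2" by (intro divide_left_mono) auto
  moreover have "1 / L \<le> 1" using AL by (simp add: divide_le_eq)
  ultimately have D: "1 / L + 3 / 4 * ?D / (A * L\<^sup>2) \<le> 3 / 4 * ?D" using assms(6) by linarith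
  have "real (cycle_number G) < 3 / 4 * ?D * (A ^ k * L ^ card (edges G))"
    using assms by (intro cycle_number_less[OF AL _ D]) (auto intro: vertex_degree_le_max_degree)
  also have "A ^ k * L ^ card (edges G) = real (Suc S) ^ r * real S ^ (k - r)"
  proof -
    \<comment> \<open>Hence \<open>A * L ^ S = S\<close>. The \<open>k * S\<close> edges of the
      equal shares give \<open>S ^ k\<close>, and each of the \<open>r\<close> extra factors
      \<open>L\<close> turns one \<open>S\<close> into \<open>S + 1\<close>.\<close>
    have inv: "real S / (real S + 1) * L = 1" using assms(5) by (simp add: L_def)
    have "A ^ k * L ^ card (edges G) = real S ^ k * ((real S / (real S + 1)) ^ S) ^ k * (L ^ S) ^ k * L ^ r"
      by (simp add: A_def assms(3) power_add power_mult_distrib power_mult[symmetric] mult.commute)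
    also have "\<dots> = real S ^ k * ((real S / (real S + 1) * L) ^ S) ^ k * L ^ r"
      by (simp only: power_mult_distrib mult_ac)
    also have "\<dots> = real S ^ (r + (k - r)) * L ^ r"
      unfolding inv using assms(4) by simp
    also have "\<dots> = (real S * L) ^ r * real S ^ (k - r)"
      by (simp only: power_add power_mult_distrib mult_ac)
    also have "real S * L = real (Suc S)" using assms(5) by (simp add: L_def)
    finally show ?thesis .
  qed
  finally show ?thesis .
qed

text \<open>With \<open>\<alpha> = r / k\<close> the \<open>k\<close>-th power makes both real
  exponents natural, which links the interpolated base to a product of balanced class sizes.\<close>

lemma powr_interpolation_power:
  fixes x y :: real
  assumes "x > 0" "y > 0" "k > 0" "r \<le> k"
  shows "(x powr (1 - real r / real k) * y powr (real r / real k)) ^ k = y ^ r * x ^ (k - r)"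
proof -
  have "real k * (1 - real r / real k) = real (k - r)"
    using assms by (simp add: right_diff_distrib of_nat_diff)
  then have "(x powr (1 - real r / real k)) ^ k = x powr real (k - r)"
    using assms by (simp add: powr_power mult.commute)
  moreover have "(y powr (real r / real k)) ^ k = y powr real r"
    using assms by (simp add: powr_power)
  ultimately show ?thesis using assms
    by (simp add: power_mult_distrib powr_realpow del: of_nat_diff)
qed

theorem theorem5p1:
  fixes n m :: nat and G :: "('v, 'e) mgraph" and s :: int and \<alpha> :: real
  assumes "n \<ge> 2" and "m \<ge> 3"
    and "cycle_maximal n m G"
    and "s = \<lfloor>real m / (real n - 1)\<rfloor>"
    and "\<alpha> = real m / (real n - 1) - of_int s"
  shows "(real m / (real n - 1) \<ge> 3 \<longrightarrow>
            8 / 27 * of_int s * (of_int s powr (1 - \<alpha>) * (of_int s + 1) powr \<alpha>) ^ (n - 1)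
              \<le> real (cycle_number G) \<and>
            real (cycle_number G)
              \<le> 3 / 4 * real (max_degree G) *
                 (of_int s powr (1 - \<alpha>) * (of_int s + 1) powr \<alpha>) ^ (n - 1))
       \<and> (real m / (real n - 1) \<le> 3 \<longrightarrow>
            4 * root 3 3 powi (int m - 4) \<le> real (cycle_number G) \<and>
            real (cycle_number G) < 3 / 4 * real (max_degree G) * root 3 3 ^ m)"
proof -
  define k S r where "k = n - 1" and "S = m div k" and "r = m mod k"
  have n: "n = Suc k" "k > 0" "real n - 1 = real k" using assms(1) by (auto simp: k_def)
  have m: "m = k * S + r" "r < k" using n by (auto simp: S_def r_def)
  have G: "multigraph G" "card (vertices G) = Suc k" "card (edges G) = m"
    using assms(3) n by (auto simp: cycle_maximal_def)
  have s: "s = int S" using assms(4) by (simp add: n S_def floor_divide_of_nat_eq)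
  have \<alpha>: "\<alpha> = real r / real k"
    using assms(5) n(2) by (simp add: n(3) s m(1) field_simps)
  show ?thesis
  proof (intro conjI[of "_ \<longrightarrow> _"] impI)
    assume "real m / (real n - 1) \<ge> 3"
    then have "3 * k \<le> m" using n by (simp add: le_divide_eq)
    then have S: "3 \<le> S" using n by (simp add: S_def less_eq_div_iff_mult_less_eq)
    have B: "(of_int s powr (1 - \<alpha>) * (of_int s + 1) powr \<alpha>) ^ (n - 1)
        = real (Suc S) ^ r * real S ^ (k - r)"
      using powr_interpolation_power[of "real S" "real S + 1" k r] S n m
      unfolding s \<alpha> k_def[symmetric] by (simp add: add.commute)
    have "8 * S * (Suc S ^ r * S ^ (k - r)) \<le> 27 * cycle_number G"
      using cycle_maximal_ge_dense[OF assms(3,1), folded k_def, OF m S] .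
    then have "real (8 * S * (Suc S ^ r * S ^ (k - r))) \<le> real (27 * cycle_number G)"
      by (simp only: of_nat_le_iff)
    then have lower: "8 / 27 * of_int s * (real (Suc S) ^ r * real S ^ (k - r)) \<le> real (cycle_number G)"
      by (simp add: s)
    \<comment> \<open>Otherwise the handshake bound gives \<open>3 * k \<le> m \<le> k + 1\<close>,
      impossible for positive \<open>k\<close>.\<close>
    have "3 \<le> max_degree G"
    proof (rule ccontr)
      assume "\<not> 3 \<le> max_degree G"
      then have "Suc k * max_degree G \<le> Suc k * 2" by (intro mult_le_mono2) simp
      then have "2 * m \<le> Suc k * 2" using two_card_edges_le[OF G(1)] unfolding G by linarith
      then show False using \<open>3 * k \<le> m\<close> n(2) by simp
    qed
    then have "real (cycle_number G)
        \<le> 3 / 4 * real (max_degree G) * (real (Suc S) ^ r * real S ^ (k - r))"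
      using cycle_number_less_dense[OF G(1,2), of S r] G(3) m S by simp
    with lower show "8 / 27 * of_int s * (of_int s powr (1 - \<alpha>) * (of_int s + 1) powr \<alpha>) ^ (n - 1)
          \<le> real (cycle_number G) \<and>
        real (cycle_number G) \<le> 3 / 4 * real (max_degree G) *
          (of_int s powr (1 - \<alpha>) * (of_int s + 1) powr \<alpha>) ^ (n - 1)"
      unfolding B ..
  next
    assume "real m / (real n - 1) \<le> 3"
    then have "m \<le> 3 * (n - 1)" using n by (simp add: divide_le_eq)
    then have lower: "4 * root 3 3 powi (int m - 4) \<le> real (cycle_number G)"
      by (rule cycle_maximal_ge_root_3_3[OF assms(3,1,2)])
    \<comment> \<open>Positivity of the lower bound guarantees a cycle, hence the maximum degree of
      at least 2 that the upper bound requires.\<close>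
    moreover have "(0::real) < 4 * root 3 3 powi (int m - 4)"
      by (intro mult_pos_pos zero_less_power_int) auto
    ultimately have "cycle_number G \<noteq> 0" by linarith
    then have "graph_cycles G \<noteq> {}" by (auto simp: cycle_number_def)
    then have "2 \<le> max_degree G" by (rule max_degree_ge_2[OF G(1)])
    then have "real (cycle_number G) < 3 / 4 * real (max_degree G) * root 3 3 ^ m"
      using cycle_number_less_root_3_3[OF G(1)] G by fastforce
    with lower show "4 * root 3 3 powi (int m - 4) \<le> real (cycle_number G) \<and>
        real (cycle_number G) < 3 / 4 * real (max_degree G) * root 3 3 ^ m" ..
  qed
qed

end
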